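(* Let $t_0\in\mathbf{R}$, let $h \in C^1[t_0,\infty)$ satisfy $h(t)>0$ for all $t \ge t_0$, and set $H(t)=\int_{t_0}^t h(s)\,ds$. Assume that $$\int_{t_0}^\infty \left| 2 h'(t) + |h(t)|^2 \right| dt < \infty$$ and that $H(t) = 2\log t + O(1)$ as $t \to \infty$. Then, for every nontrivial solution $(x(t),y(t))$ on $[t_0,\infty)$ of the linear system $$x' = y, \qquad y' = -x-h(t)y,$$ there exists $t_1 \ge t_0$ such that $\dim_{\rm B}\Gamma_{(x,y;t_1)}=1$.
   Context: A solution is nontrivial if it is not identically $(0,0)$. For a solution $(x(t),y(t))$ and $t_1\ge t_0$, the solution curve is $\Gamma_{(x,y;t_1)} = \{ (x(t),y(t)) : t \ge t_1 \}\subset\mathbf{R}^2$. The notation $f(t)=O(1)$ as $t\to\infty$ means that there exist $M>0$ and $T$ such that $|f(t)|\le M$ for $t\ge T$. For a bounded set $\Gamma\subset\mathbf{R}^2$, the box-counting (Minkowski-Bouligand) dimension is $$\dim_{\rm B} \Gamma = 2 - \lim_{\varepsilon \to +0} \frac{\log|\Gamma_\varepsilon|}{\log \varepsilon},$$ where $\Gamma_\varepsilon = \{ (x,y) \in \mathbf{R}^2 : d((x,y),\Gamma) \le \varepsilon \}$, $d$ is the Euclidean distance, and $|\Gamma_\varepsilon|$ is the two-dimensional Lebesgue measure of $\Gamma_\varepsilon$. The assertion $\dim_{\rm B}\Gamma=d$ includes that the limit exists. *)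

theory Defs
  imports "HOL-Analysis.Analysis" "HOL-Library.Landau_Symbols"
begin

text \<open>The plane is modelled by \<^typ>\<open>real \<times> real\<close>, whose \<^const>\<open>dist\<close> is the Euclidean distance.
  Values of the functions at times before \<open>t0\<close> are irrelevant: the derivative is one-sided at the
  left end point.\<close>

definition is_solution :: "real \<Rightarrow> (real \<Rightarrow> real) \<Rightarrow> (real \<Rightarrow> real) \<Rightarrow> (real \<Rightarrow> real) \<Rightarrow> bool" where
  "is_solution t0 h x y \<longleftrightarrow>
     (\<forall>t\<ge>t0. (x has_real_derivative y t) (at t within {t0..}) \<and>
             (y has_real_derivative (- x t - h t * y t)) (at t within {t0..}))"

definition nontrivial :: "real \<Rightarrow> (real \<Rightarrow> real) \<Rightarrow> (real \<Rightarrow> real) \<Rightarrow> bool" where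
  "nontrivial t0 x y \<longleftrightarrow> (\<exists>t\<ge>t0. (x t, y t) \<noteq> (0, 0))"

definition solution_curve :: "(real \<Rightarrow> real) \<Rightarrow> (real \<Rightarrow> real) \<Rightarrow> real \<Rightarrow> (real \<times> real) set" where
  "solution_curve x y t1 = {(x t, y t) | t. t \<ge> t1}"

text \<open>Only meant for nonempty sets, since \<^term>\<open>infdist p {} = 0\<close>.\<close>

definition closed_nbhd :: "real \<Rightarrow> (real \<times> real) set \<Rightarrow> (real \<times> real) set" where
  "closed_nbhd \<epsilon> \<Gamma> = {p. infdist p \<Gamma> \<le> \<epsilon>}"

text \<open>A relation rather than a function, so that asserting a value for the dimension
  includes boundedness of the set and existence of the limit.\<close>

definition has_box_dim :: "(real \<times> real) set \<Rightarrow> real \<Rightarrow> bool" where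
  "has_box_dim \<Gamma> d \<longleftrightarrow> bounded \<Gamma> \<and>
     (\<exists>L. ((\<lambda>\<epsilon>. ln (measure lebesgue (closed_nbhd \<epsilon> \<Gamma>)) / ln \<epsilon>) \<longlongrightarrow> L) (at_right 0) \<and>
          d = 2 - L)"

end

theory Submission
  imports Defs "HOL-Real_Asymp.Real_Asymp"
begin

text \<open>Since \<open>H(t) = 2 log t + O(1)\<close>, solutions decay like \<open>1/t\<close>, and so do their velocities. Hence
  \<open>\<sigma>(s) = (x(e\<^sup>s), y(e\<^sup>s))\<close> is a Lipschitz curve with \<open>|\<sigma>(s)| = O(e\<^bsup>-s\<^esup>)\<close>. For
  \<open>s \<ge> log(1/\<epsilon>)\<close> it stays in a ball of radius \<open>O(\<epsilon>)\<close> about the origin; the rest is covered by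
  \<open>O(log(1/\<epsilon>)/\<epsilon>)\<close> balls of radius \<open>O(\<epsilon>)\<close>. So \<open>|\<Gamma>\<^sub>\<epsilon>| = O(\<epsilon> log(1/\<epsilon>))\<close>, and
  the logarithm does not affect the dimension. Conversely \<open>|\<Gamma>\<^sub>\<epsilon>| \<ge> c \<epsilon>\<close> because \<open>\<Gamma>\<close> is
  connected and not a single point, so a lower bound on the decay rate is unnecessary.\<close>

section \<open>Area of closed neighbourhoods and box dimension 1\<close>

lemma closed_closed_nbhd: "closed (closed_nbhd \<epsilon> \<Gamma>)"
  unfolding closed_nbhd_def
  by (intro closed_Collect_le continuous_intros)

text \<open>The infimum behind \<open>infdist\<close> need not be attained, as \<Gamma> need not be
  closed; a radius strictly larger than \<epsilon> leaves room to pick an actual point of \<Gamma>.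
  This is why 2 * \<epsilon> appears in later covering bounds.\<close>

lemma closed_nbhd_subset_balls:
  assumes "\<Gamma> \<noteq> {}" "\<epsilon> < \<delta>"
  shows "closed_nbhd \<epsilon> \<Gamma> \<subseteq> (\<Union>a\<in>\<Gamma>. ball a \<delta>)"
proof
  fix p assume "p \<in> closed_nbhd \<epsilon> \<Gamma>"
  then have "(INF a\<in>\<Gamma>. dist p a) < \<delta>"
    using assms by (simp add: closed_nbhd_def infdist_notempty)
  then obtain a where "a \<in> \<Gamma>" "dist p a < \<delta>"
    using assms(1) by (subst (asm) cINF_less_iff) (auto intro: bdd_belowI[of _ 0])
  then show "p \<in> (\<Union>a\<in>\<Gamma>. ball a \<delta>)"
    by (auto simp: dist_commute)
qed

lemma bounded_closed_nbhd:
  assumes "bounded \<Gamma>" "\<Gamma> \<noteq> {}"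
  shows "bounded (closed_nbhd \<epsilon> \<Gamma>)"
proof -
  obtain B where B: "\<And>a. a \<in> \<Gamma> \<Longrightarrow> norm a \<le> B"
    using assms(1) by (auto simp: bounded_iff)
  have "norm p \<le> B + (\<epsilon> + 1)" if "p \<in> closed_nbhd \<epsilon> \<Gamma>" for p
  proof -
    obtain a where a: "a \<in> \<Gamma>" "dist a p < \<epsilon> + 1"
      using closed_nbhd_subset_balls[OF assms(2), of \<epsilon> "\<epsilon> + 1"] \<open>p \<in> closed_nbhd \<epsilon> \<Gamma>\<close> by auto
    have "norm p \<le> norm a + dist a p"
      by (metis dist_norm norm_minus_commute norm_triangle_sub)
    then show ?thesis using B[OF a(1)] a(2) by linarith
  qed
  then show ?thesis by (rule boundedI)
qed

lemma lmeasurable_closed_nbhd: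
  assumes "bounded \<Gamma>" "\<Gamma> \<noteq> {}"
  shows "closed_nbhd \<epsilon> \<Gamma> \<in> lmeasurable"
  using bounded_closed_nbhd[OF assms] closed_closed_nbhd
  by (simp add: compact_eq_bounded_closed lmeasurable_compact)

lemma content_plane_ball:
  fixes c :: "real \<times> real"
  assumes "r \<ge> 0"
  shows "measure lborel (ball c r) = pi * r\<^sup>2"
  using content_ball[of r c] assms by (simp add: unit_ball_vol_2 power2_eq_square)

lemma measure_closed_nbhd_le_cover:
  fixes \<Gamma> :: "(real \<times> real) set"
  assumes "\<Gamma> \<noteq> {}" "finite F" "\<Gamma> \<subseteq> (\<Union>c\<in>F. cball c r)" "0 < \<epsilon>" "0 \<le> r"
  shows "measure lebesgue (closed_nbhd \<epsilon> \<Gamma>) \<le> real (card F) * (pi * (r + 2 * \<epsilon>)\<^sup>2)"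
proof -
  have "closed_nbhd \<epsilon> \<Gamma> \<subseteq> (\<Union>a\<in>\<Gamma>. ball a (2 * \<epsilon>))"
    using assms by (intro closed_nbhd_subset_balls) auto
  also have "\<dots> \<subseteq> (\<Union>c\<in>F. ball c (r + 2 * \<epsilon>))"
  proof (intro UN_least subsetI)
    fix a p assume "a \<in> \<Gamma>" and p: "p \<in> ball a (2 * \<epsilon>)"
    then obtain c where c: "c \<in> F" "dist c a \<le> r"
      using assms(3) by auto
    have "dist c p < r + 2 * \<epsilon>"
      using dist_triangle[of c p a] c(2) p by auto
    then show "p \<in> (\<Union>c\<in>F. ball c (r + 2 * \<epsilon>))"
      using c(1) by auto
  qed
  finally have "measure lebesgue (closed_nbhd \<epsilon> \<Gamma>) \<le> measure lebesgue (\<Union>c\<in>F. ball c (r + 2 * \<epsilon>))"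
    by (rule measure_mono_fmeasurable)
       (use assms closed_closed_nbhd in \<open>auto intro!: fmeasurable.finite_UN lmeasurable_ball borel_closed\<close>)
  also have "\<dots> \<le> (\<Sum>c\<in>F. measure lebesgue (ball c (r + 2 * \<epsilon>)))"
    using assms by (intro measure_UNION_le) auto
  also have "\<dots> = real (card F) * (pi * (r + 2 * \<epsilon>)\<^sup>2)"
    using assms by (simp add: content_plane_ball)
  finally show ?thesis .
qed

text \<open>Points of the connected set at distances \<open>0, 2\<epsilon>, 4\<epsilon>, \<dots>\<close> from \<open>p\<close> are centres of
  disjoint \<open>\<epsilon>\<close>-balls.\<close>

lemma measure_closed_nbhd_connected_ge:
  fixes \<Gamma> :: "(real \<times> real) set"
  assumes "connected \<Gamma>" "bounded \<Gamma>" "p \<in> \<Gamma>" "q \<in> \<Gamma>" "0 < \<epsilon>"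
  shows "pi * dist p q / 2 * \<epsilon> \<le> measure lebesgue (closed_nbhd \<epsilon> \<Gamma>)"
proof -
  define d where "d = dist p q"
  \<comment> \<open>Intermediate values: the distance from \<open>p\<close> takes every value in
    [0, d] on \<Gamma>.\<close>
  have "connected (dist p ` \<Gamma>)"
    by (intro connected_continuous_image continuous_intros assms)
  moreover have "0 \<in> dist p ` \<Gamma>" "d \<in> dist p ` \<Gamma>"
    using assms by (auto simp: d_def intro!: image_eqI[of 0 _ p])
  ultimately have "\<exists>z\<in>\<Gamma>. dist p z = s" if "0 \<le> s" "s \<le> d" for s
    using that by (metis connected_iff_interval imageE)
  then obtain z where z: "\<And>s. 0 \<le> s \<Longrightarrow> s \<le> d \<Longrightarrow> z s \<in> \<Gamma> \<and> dist p (z s) = s"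
    by metis
  \<comment> \<open>The centres have indices 0, ..., N, so there are N + 1 of them. Hence their
    number is at least d / (2 * \<epsilon>) for every \<epsilon>, even when N = 0.\<close>
  define N where "N = nat \<lfloor>d / (2 * \<epsilon>)\<rfloor>"
  have d0: "d \<ge> 0" by (simp add: d_def)
  have N: "real N \<le> d / (2 * \<epsilon>)" "d / (2 * \<epsilon>) \<le> real (Suc N)"
    using assms(5) d0 unfolding N_def by (auto simp: of_nat_nat) linarith+
  define c where "c k = z (2 * \<epsilon> * real k)" for k :: nat
  have c: "c k \<in> \<Gamma>" "dist p (c k) = 2 * \<epsilon> * real k" if "k \<le> N" for k
  proof -
    have "real k \<le> d / (2 * \<epsilon>)" using N(1) that by linarith
    then have "2 * \<epsilon> * real k \<le> d" using assms(5) by (simp add: field_simps)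
    then show "c k \<in> \<Gamma>" "dist p (c k) = 2 * \<epsilon> * real k"
      using z[of "2 * \<epsilon> * real k"] assms(5) by (auto simp: c_def)
  qed
  have disj: "disjoint_family_on (\<lambda>k. ball (c k) \<epsilon>) {..N}"
    unfolding disjoint_family_on_def
  proof (intro ballI impI)
    fix i j assume ij: "i \<in> {..N}" "j \<in> {..N}" "i \<noteq> j"
    have "2 * \<epsilon> * 1 \<le> 2 * \<epsilon> * \<bar>real i - real j\<bar>"
      using assms(5) ij(3) by (intro mult_left_mono) auto
    also have "\<dots> = \<bar>dist p (c i) - dist p (c j)\<bar>"
      using c(2)[of i] c(2)[of j] ij assms(5) by (simp add: abs_mult flip: right_diff_distrib)
    also have "\<dots> \<le> dist (c i) (c j)"
      by (simp add: abs_le_iff) (metis add.commute dist_commute dist_triangle2 diff_le_eq)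
    finally show "ball (c i) \<epsilon> \<inter> ball (c j) \<epsilon> = {}"
      by (intro disjoint_ballI) auto
  qed
  have sub: "(\<Union>k\<in>{..N}. ball (c k) \<epsilon>) \<subseteq> closed_nbhd \<epsilon> \<Gamma>"
  proof (intro UN_least subsetI)
    fix k u assume "k \<in> {..N}" "u \<in> ball (c k) \<epsilon>"
    then show "u \<in> closed_nbhd \<epsilon> \<Gamma>"
      using c(1)[of k] by (auto simp: closed_nbhd_def dist_commute intro!: infdist_le2)
  qed
  have "pi * d / 2 * \<epsilon> = d / (2 * \<epsilon>) * (pi * \<epsilon>\<^sup>2)"
    using assms(5) by (simp add: field_simps power2_eq_square)
  also have "\<dots> \<le> real (Suc N) * (pi * \<epsilon>\<^sup>2)"
    using N(2) by (intro mult_right_mono) auto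
  also have "\<dots> = (\<Sum>k\<in>{..N}. measure lebesgue (ball (c k) \<epsilon>))"
    using assms(5) by (simp add: content_plane_ball)
  also have "\<dots> = measure lebesgue (\<Union>k\<in>{..N}. ball (c k) \<epsilon>)"
    using disj by (intro measure_finite_Union[symmetric])
      (use emeasure_lborel_ball_finite in \<open>auto simp: less_top\<close>)
  also have "\<dots> \<le> measure lebesgue (closed_nbhd \<epsilon> \<Gamma>)"
    using sub lmeasurable_closed_nbhd assms
    by (intro measure_mono_fmeasurable) (auto intro!: fmeasurableD)
  finally show ?thesis by (simp add: d_def)
qed

text \<open>One constant \<open>C\<close> bounds both the Lipschitz ratio and the decay, so balls of
  the same radius C * \<epsilon> cover the initial arc, sampled with step \<epsilon>, and the tail
  near the origin.\<close>

lemma measure_closed_nbhd_lipschitz_curve_le: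
  fixes \<sigma> :: "real \<Rightarrow> real \<times> real"
  assumes lip: "C-lipschitz_on {s1..} \<sigma>"
    and decay: "\<And>s. s \<ge> s1 \<Longrightarrow> norm (\<sigma> s) \<le> C * exp (- s)"
    and "0 \<le> s1" "0 < \<epsilon>" "\<epsilon> < 1"
  shows "measure lebesgue (closed_nbhd \<epsilon> (\<sigma> ` {s1..})) \<le>
           pi * (C + 2)\<^sup>2 * (\<epsilon> * ln (1 / \<epsilon>) + 3 * \<epsilon>\<^sup>2)"
proof -
  have C: "C \<ge> 0" using lip by (simp add: lipschitz_on_def)
  define l where "l = ln (1 / \<epsilon>)"
  have l: "l > 0" "exp (- l) = \<epsilon>"
    using assms by (auto simp: l_def ln_div)
  \<comment> \<open>At \<open>l\<close> the factor exp (- s) has dropped to \<epsilon>. As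
    \<open>s1\<close> is nonnegative, \<open>N\<close> steps of length \<epsilon> from
    \<open>s1\<close> reach at least \<open>l\<close>.\<close>
  define N where "N = nat \<lceil>l / \<epsilon>\<rceil>"
  have N: "l / \<epsilon> \<le> real N" "real N \<le> l / \<epsilon> + 1"
    using l assms unfolding N_def by (auto simp: of_nat_nat)
  \<comment> \<open>The origin serves the tail, the sample points the initial arc. The 3 in the
    bound counts the origin, the sample at k = 0 and the rounding in \<open>N\<close>.\<close>
  define F where "F = insert 0 ((\<lambda>k. \<sigma> (s1 + real k * \<epsilon>)) ` {..N})"
  have "card F \<le> Suc (card ((\<lambda>k. \<sigma> (s1 + real k * \<epsilon>)) ` {..N}))"
    unfolding F_def by (rule card_insert_le_m1[THEN order_trans]) auto
  also have "\<dots> \<le> Suc (Suc N)"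
    using card_image_le[of "{..N}"] by force
  finally have cardF: "real (card F) \<le> l / \<epsilon> + 3"
    using N(2) by linarith
  have "\<sigma> ` {s1..} \<subseteq> (\<Union>c\<in>F. cball c (C * \<epsilon>))"
  proof (intro image_subsetI)
    fix s assume s: "s \<in> {s1..}"
    show "\<sigma> s \<in> (\<Union>c\<in>F. cball c (C * \<epsilon>))"
    proof (cases "s \<le> s1 + real N * \<epsilon>")
      case True
      \<comment> \<open>The last sample time not after \<open>s\<close>, hence at most \<epsilon>
        before it.\<close>
      define k where "k = nat \<lfloor>(s - s1) / \<epsilon>\<rfloor>"
      have k: "real k \<le> (s - s1) / \<epsilon>" "(s - s1) / \<epsilon> \<le> real k + 1"
        using s assms unfolding k_def by (auto simp: of_nat_nat)
      have "(s - s1) / \<epsilon> \<le> real N"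
        using True assms by (simp add: field_simps)
      with k have "k \<le> N" by linarith
      have "dist (\<sigma> (s1 + real k * \<epsilon>)) (\<sigma> s) \<le> C * dist (s1 + real k * \<epsilon>) s"
        using s assms by (intro lipschitz_onD[OF lip]) auto
      also have "\<dots> \<le> C * \<epsilon>"
        using k assms C by (intro mult_left_mono) (auto simp: dist_real_def field_simps abs_le_iff)
      finally show ?thesis
        using \<open>k \<le> N\<close> by (auto simp: F_def)
    next
      case False
      have "l \<le> real N * \<epsilon>" using N(1) assms by (simp add: field_simps)
      with False assms have "l \<le> s" by linarith
      then have "exp (- s) \<le> \<epsilon>" using l(2) by (metis exp_le_cancel_iff neg_le_iff_le)
      then have "norm (\<sigma> s) \<le> C * \<epsilon>"
        using decay[of s] s C by (meson atLeast_iff mult_left_mono order_trans)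
      then show ?thesis by (auto simp: F_def)
    qed
  qed
  then have "measure lebesgue (closed_nbhd \<epsilon> (\<sigma> ` {s1..})) \<le> real (card F) * (pi * (C * \<epsilon> + 2 * \<epsilon>)\<^sup>2)"
    using assms C by (intro measure_closed_nbhd_le_cover) (auto simp: F_def)
  also have "\<dots> \<le> (l / \<epsilon> + 3) * (pi * (C * \<epsilon> + 2 * \<epsilon>)\<^sup>2)"
    using cardF by (intro mult_right_mono) auto
  also have "\<dots> = pi * (C + 2)\<^sup>2 * (\<epsilon> * l + 3 * \<epsilon>\<^sup>2)"
    using assms by (simp add: field_simps power2_eq_square)
  finally show ?thesis by (simp add: l_def)
qed

text \<open>Constants and the logarithmic factor contribute only o(ln \<epsilon>) to the logarithm
  of the area, so both bounds give a quotient tending to 1, and 2 - 1 = 1. As ln \<epsilon> is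
  negative, the upper area bound gives the lower bound of the quotient and vice versa.\<close>

lemma has_box_dim_1I:
  assumes "bounded \<Gamma>" "0 < c" "0 < K"
    and lower: "\<And>\<epsilon>. 0 < \<epsilon> \<Longrightarrow> \<epsilon> < 1 \<Longrightarrow> c * \<epsilon> \<le> measure lebesgue (closed_nbhd \<epsilon> \<Gamma>)"
    and upper: "\<And>\<epsilon>. 0 < \<epsilon> \<Longrightarrow> \<epsilon> < 1 \<Longrightarrow>
      measure lebesgue (closed_nbhd \<epsilon> \<Gamma>) \<le> K * (\<epsilon> * ln (1 / \<epsilon>) + 3 * \<epsilon>\<^sup>2)"
  shows "has_box_dim \<Gamma> 1"
proof -
  let ?m = "\<lambda>\<epsilon>. measure lebesgue (closed_nbhd \<epsilon> \<Gamma>)"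
  have ev: "eventually (\<lambda>\<epsilon>. 0 < \<epsilon> \<and> \<epsilon> < 1) (at_right (0::real))"
    by (auto simp: eventually_at_right_field intro: exI[of _ 1])
  have "((\<lambda>\<epsilon>. ln (?m \<epsilon>) / ln \<epsilon>) \<longlongrightarrow> 1) (at_right 0)"
  proof (rule tendsto_sandwich)
    show "\<forall>\<^sub>F \<epsilon> in at_right 0. ln (K * (\<epsilon> * ln (1 / \<epsilon>) + 3 * \<epsilon>\<^sup>2)) / ln \<epsilon> \<le> ln (?m \<epsilon>) / ln \<epsilon>"
      using ev
    proof eventually_elim
      case (elim \<epsilon>)
      then have "0 < ?m \<epsilon>" using lower[of \<epsilon>] assms(2) by (smt (verit) mult_pos_pos)
      with upper[of \<epsilon>] elim show ?case
        by (intro divide_right_mono_neg) auto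
    qed
    show "\<forall>\<^sub>F \<epsilon> in at_right 0. ln (?m \<epsilon>) / ln \<epsilon> \<le> ln (c * \<epsilon>) / ln \<epsilon>"
      using ev
    proof eventually_elim
      case (elim \<epsilon>)
      then have "0 < c * \<epsilon>" using assms(2) by simp
      with lower[of \<epsilon>] elim show ?case
        by (intro divide_right_mono_neg) auto
    qed
    show "((\<lambda>\<epsilon>. ln (K * (\<epsilon> * ln (1 / \<epsilon>) + 3 * \<epsilon>\<^sup>2)) / ln \<epsilon>) \<longlongrightarrow> 1) (at_right 0)"
      using assms(3) by real_asymp
    show "((\<lambda>\<epsilon>. ln (c * \<epsilon>) / ln \<epsilon>) \<longlongrightarrow> 1) (at_right 0)"
      using assms(2) by real_asymp
  qed
  then show ?thesis
    unfolding has_box_dim_def using assms(1) by (intro conjI exI[of _ 1]) auto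
qed

section \<open>Integrals with variable upper limit\<close>

lemma DERIV_continuous_integral_from:
  assumes "continuous_on {a..} g" "a < t"
  shows "((\<lambda>t. integral {a..t} g) has_real_derivative g t) (at t)"
proof -
  have "continuous_on {a..t + 1} g"
    using assms(1) by (rule continuous_on_subset) auto
  then have "((\<lambda>t. integral {a..t} g) has_real_derivative g t) (at t within {a..t + 1})"
    using assms(2) by (intro integral_has_real_derivative) auto
  then show ?thesis
    using assms(2) by (simp add: at_within_Icc_at)
qed

lemma continuous_on_integral_from:
  fixes g :: "real \<Rightarrow> real"
  assumes "continuous_on {a..} g"
  shows "continuous_on {a..} (\<lambda>t. integral {a..t} g)"
proof -
  have "continuous_on {a..b} (\<lambda>t. integral {a..t} g)" for b
    by (intro indefinite_integral_continuous_1 integrable_continuous_real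
        continuous_on_subset[OF assms]) auto
  then have "\<forall>t\<in>{a..}. continuous (at t within {a..}) (\<lambda>t. integral {a..t} g)"
  proof (intro ballI)
    fix t assume "t \<in> {a..}"
    \<comment> \<open>Continuity is local, so the half-line may be cut off at t + 1.\<close>
    have "at t within {a..} = at t within {a..t + 1}"
      by (rule at_within_nhd[of t "{..<t + 1}"]) (use \<open>t \<in> {a..}\<close> in auto)
    then show "continuous (at t within {a..}) (\<lambda>t. integral {a..t} g)"
      using \<open>\<And>b. continuous_on {a..b} (\<lambda>t. integral {a..t} g)\<close>[of "t + 1"] \<open>t \<in> {a..}\<close>
      by (simp add: continuous_on_eq_continuous_within)
  qed
  then show ?thesis by (simp add: continuous_on_eq_continuous_within)
qed

section \<open>Energy estimates for the damped oscillator\<close>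

text \<open>The energy \<open>x\<^sup>2 + (y + h x / 2)\<^sup>2\<close> is the one of \<open>u = x e\<^bsup>H/2\<^esup>\<close>, which solves
  \<open>u'' + (1 - (2h' + h\<^sup>2) / 4) u = 0\<close>, scaled back by \<open>e\<^bsup>-H\<^esup>\<close>.\<close>

locale damped_oscillator =
  fixes t0 :: real and h h' x y :: "real \<Rightarrow> real"
  assumes h_deriv: "\<And>t. t \<ge> t0 \<Longrightarrow> (h has_real_derivative h' t) (at t within {t0..})"
    and h'_cont: "continuous_on {t0..} h'"
    and h_pos: "\<And>t. t \<ge> t0 \<Longrightarrow> h t > 0"
    and integrable: "(\<lambda>t. 2 * h' t + \<bar>h t\<bar>\<^sup>2) absolutely_integrable_on {t0..}"
    and sol: "is_solution t0 h x y"
begin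

definition g :: "real \<Rightarrow> real" where "g t = \<bar>2 * h' t + (h t)\<^sup>2\<bar>"
definition G :: "real \<Rightarrow> real" where "G t = integral {t0..t} g"
definition H :: "real \<Rightarrow> real" where "H t = integral {t0..t} h"
text \<open>For u = x e^(H/2) the product rule gives u' = v e^(H/2).\<close>

definition v :: "real \<Rightarrow> real" where "v t = y t + h t * x t / 2"
definition W :: "real \<Rightarrow> real" where "W t = (x t)\<^sup>2 + (v t)\<^sup>2"

lemma continuous [continuous_intros]:
  "continuous_on {t0..} h" "continuous_on {t0..} x" "continuous_on {t0..} y"
  using h_deriv sol unfolding is_solution_def
  by (auto intro!: DERIV_continuous_on)

lemma continuous_g: "continuous_on {t0..} g"
  unfolding g_def by (intro continuous_intros h'_cont)

lemma DERIV_at: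
  assumes "t > t0"
  shows "(h has_real_derivative h' t) (at t)" "(x has_real_derivative y t) (at t)"
    "(y has_real_derivative (- x t - h t * y t)) (at t)"
proof -
  have "at t within {t0..} = at t"
    by (rule at_within_interior) (use assms in auto)
  then show "(h has_real_derivative h' t) (at t)" "(x has_real_derivative y t) (at t)"
    "(y has_real_derivative (- x t - h t * y t)) (at t)"
    using h_deriv[of t] sol assms unfolding is_solution_def by (auto dest: less_imp_le)
qed

lemma DERIV_H: "t > t0 \<Longrightarrow> (H has_real_derivative h t) (at t)"
  unfolding H_def by (intro DERIV_continuous_integral_from continuous)

lemma DERIV_G: "t > t0 \<Longrightarrow> (G has_real_derivative g t) (at t)"
  unfolding G_def by (intro DERIV_continuous_integral_from continuous_g)

lemma continuous_HGW [continuous_intros]: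
  "continuous_on {t0..} H" "continuous_on {t0..} G" "continuous_on {t0..} W"
  unfolding H_def G_def W_def v_def
  by (intro continuous_intros continuous_on_integral_from continuous_g; simp)+

lemma G_le: "G t \<le> integral {t0..} g"
proof -
  have "g integrable_on {t0..}"
    using absolutely_integrable_on_def[THEN iffD1, OF integrable] by (simp add: g_def[abs_def])
  moreover have "g integrable_on {t0..t}"
    by (intro integrable_continuous_real continuous_on_subset[OF continuous_g]) auto
  ultimately show ?thesis
    unfolding G_def by (intro integral_subset_le) (auto simp: g_def)
qed

text \<open>As h^2 is nonnegative, 2 h' is at most \<open>g\<close>, so 2 h - G is nonincreasing.
  The resulting bound on \<open>h\<close> allows \<open>y\<close> to be recovered from
  \<open>v\<close> and \<open>x\<close>.\<close>

lemma h_le: "t \<ge> t0 \<Longrightarrow> 2 * h t \<le> 2 * h t0 + integral {t0..} g"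
proof -
  assume t: "t \<ge> t0"
  have "2 * h t - G t \<le> 2 * h t0 - G t0"
  proof (rule DERIV_nonpos_imp_decreasing_open[OF t])
    fix s assume s: "t0 < s" "s < t"
    have "((\<lambda>s. 2 * h s - G s) has_real_derivative 2 * h' s - g s) (at s)"
      by (rule derivative_eq_intros DERIV_at DERIV_G s refl)+ simp
    moreover have "2 * h' s - g s \<le> 0"
      using zero_le_power2[of "h s"] unfolding g_def by linarith
    ultimately show "\<exists>y. ((\<lambda>s. 2 * h s - G s) has_real_derivative y) (at s) \<and> y \<le> 0"
      by blast
  qed (intro continuous_intros; auto intro: continuous_on_subset continuous continuous_HGW)
  then show ?thesis using G_le[of t] by (simp add: G_def)
qed

text \<open>Substituting y = v - h x / 2 gives v' = - x - h v / 2 + (2 h' + h^2) x / 4. The terms 2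
  x v and - 2 x v cancel in the derivative of \<open>W\<close>, which leaves the damping - h W and a
  cross term with absolutely integrable coefficient.\<close>

lemma DERIV_W:
  assumes "t > t0"
  shows "(W has_real_derivative (- h t * W t + (2 * h' t + (h t)\<^sup>2) / 2 * (x t * v t))) (at t)"
  unfolding W_def[abs_def] v_def
  by (auto intro!: derivative_eq_intros DERIV_at assms simp: field_simps power2_eq_square)

lemma abs_W_perturbation_le:
  "\<bar>(2 * h' t + (h t)\<^sup>2) / 2 * (x t * v t)\<bar> \<le> g t / 4 * W t"
proof -
  have "2 * \<bar>x t * v t\<bar> \<le> W t"
    using zero_le_power2[of "\<bar>x t\<bar> - \<bar>v t\<bar>"]
    by (simp add: W_def power2_diff abs_mult)
  then have "g t / 4 * (2 * \<bar>x t * v t\<bar>) \<le> g t / 4 * W t"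
    by (intro mult_left_mono) (auto simp: g_def)
  then show ?thesis by (simp add: g_def abs_mult)
qed

text \<open>Gronwall with an integrating factor: W' is at most (- h + g / 4) W, and H - G / 4 is a
  primitive of h - g / 4.\<close>

lemma W_upper:
  assumes "t0 \<le> s" "s \<le> t"
  shows "W t * exp (H t - G t / 4) \<le> W s * exp (H s - G s / 4)"
proof (rule DERIV_nonpos_imp_decreasing_open[OF assms(2)])
  fix r assume r: "s < r" "r < t"
  then have "t0 < r" using assms by simp
  let ?p = "(2 * h' r + (h r)\<^sup>2) / 2 * (x r * v r)"
  have "((\<lambda>r. W r * exp (H r - G r / 4)) has_real_derivative
      (?p - g r / 4 * W r) * exp (H r - G r / 4)) (at r)"
    by (auto intro!: derivative_eq_intros DERIV_W DERIV_H DERIV_G \<open>t0 < r\<close> simp: algebra_simps)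
  moreover have "(?p - g r / 4 * W r) * exp (H r - G r / 4) \<le> 0"
    using abs_W_perturbation_le[of r] unfolding abs_le_iff by (intro mult_nonpos_nonneg) (linarith, simp)
  ultimately show "\<exists>d. ((\<lambda>r. W r * exp (H r - G r / 4)) has_real_derivative d) (at r) \<and> d \<le> 0"
    by blast
next
  show "continuous_on {s..t} (\<lambda>r. W r * exp (H r - G r / 4))"
    by (rule continuous_on_subset[of "{t0..}"]) (use assms in \<open>auto intro!: continuous_intros\<close>)
qed

text \<open>The reverse Gronwall estimate, from W' being at least (- h - g / 4) W. It keeps a
  positive energy positive.\<close>

lemma W_lower:
  assumes "t0 \<le> s" "s \<le> t"
  shows "W s * exp (H s + G s / 4) \<le> W t * exp (H t + G t / 4)"
proof (rule DERIV_nonneg_imp_increasing_open[OF assms(2)])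
  fix r assume r: "s < r" "r < t"
  then have "t0 < r" using assms by simp
  let ?p = "(2 * h' r + (h r)\<^sup>2) / 2 * (x r * v r)"
  have "((\<lambda>r. W r * exp (H r + G r / 4)) has_real_derivative
      (?p + g r / 4 * W r) * exp (H r + G r / 4)) (at r)"
    by (auto intro!: derivative_eq_intros DERIV_W DERIV_H DERIV_G \<open>t0 < r\<close> simp: algebra_simps)
  moreover have "(?p + g r / 4 * W r) * exp (H r + G r / 4) \<ge> 0"
    using abs_W_perturbation_le[of r] unfolding abs_le_iff by (intro mult_nonneg_nonneg) (linarith, simp)
  ultimately show "\<exists>d. ((\<lambda>r. W r * exp (H r + G r / 4)) has_real_derivative d) (at r) \<and> d \<ge> 0"
    by blast
next
  show "continuous_on {s..t} (\<lambda>r. W r * exp (H r + G r / 4))"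
    by (rule continuous_on_subset[of "{t0..}"]) (use assms in \<open>auto intro!: continuous_intros\<close>)
qed

lemma W_eq_0_iff: "W t = 0 \<longleftrightarrow> x t = 0 \<and> y t = 0"
  by (auto simp: W_def v_def sum_power2_eq_zero_iff)

text \<open>The lower energy estimate takes the place of a uniqueness theorem for the zero
  solution.\<close>

lemma nontrivial_stays:
  assumes "t0 \<le> s" "s \<le> t" "(x s, y s) \<noteq> (0, 0)"
  shows "(x t, y t) \<noteq> (0, 0)"
proof -
  have "W s \<noteq> 0" using assms(3) W_eq_0_iff[of s] by auto
  then have "W s > 0" by (simp add: W_def less_le)
  then have "0 < W s * exp (H s + G s / 4)" by simp
  also have "\<dots> \<le> W t * exp (H t + G t / 4)" by (rule W_lower[OF assms(1,2)])
  finally show ?thesis using W_eq_0_iff[of t] by auto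
qed

lemma solution_decay:
  assumes "(\<lambda>t. H t - 2 * ln t) \<in> O[at_top](\<lambda>_. 1)"
  obtains A T where "A > 0" "\<And>t. t \<ge> T \<Longrightarrow> t \<ge> t0 \<Longrightarrow> \<bar>x t\<bar> \<le> A / t \<and> \<bar>y t\<bar> \<le> A / t"
proof -
  obtain M where "eventually (\<lambda>t. \<bar>H t - 2 * ln t\<bar> \<le> M) at_top"
    using assms by (auto elim!: landau_o.bigE)
  then obtain T where T: "\<And>t. t \<ge> T \<Longrightarrow> \<bar>H t - 2 * ln t\<bar> \<le> M"
    by (auto simp: eventually_at_top_linorder)
  define I where "I = integral {t0..} g"
  \<comment> \<open>Chosen so that W t0 * exp (I / 4 + M - 2 ln t) = (K / t)^2. This bounds
    \<open>W t\<close> because \<open>H\<close> and \<open>G\<close> vanish at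
    \<open>t0\<close>.\<close>
  define K where "K = sqrt (W t0 * exp (I / 4 + M))"
  define B where "B = h t0 + I / 2"
  have K: "K \<ge> 0" by (simp add: K_def W_def)
  have B: "0 < h t" "h t \<le> B" if "t \<ge> t0" for t
    using h_le[OF that] h_pos[OF that] by (auto simp: B_def I_def)
  have B0: "B > 0" using B[of t0] by simp
  have xv: "\<bar>x t\<bar> \<le> K / t \<and> \<bar>v t\<bar> \<le> K / t" if t: "t \<ge> max T 1" "t \<ge> t0" for t
  proof -
    have "W t * exp (H t - G t / 4) \<le> W t0"
      using W_upper[OF order_refl t(2)] by (simp add: H_def G_def)
    then have "W t * exp (H t - G t / 4) * exp (G t / 4 - H t) \<le> W t0 * exp (G t / 4 - H t)"
      by (rule mult_right_mono) simp
    then have "W t \<le> W t0 * exp (G t / 4 - H t)"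
      by (simp add: mult.assoc flip: exp_add)
    also have "\<dots> \<le> W t0 * exp (I / 4 + M - 2 * ln t)"
      using T[of t] t G_le[of t] by (intro mult_left_mono) (auto simp: I_def W_def abs_le_iff)
    also have "\<dots> = (K / t)\<^sup>2"
      using t by (simp add: K_def W_def exp_diff power_divide exp_double)
    finally have "(x t)\<^sup>2 \<le> (K / t)\<^sup>2" "(v t)\<^sup>2 \<le> (K / t)\<^sup>2"
      unfolding W_def using zero_le_power2[of "x t"] zero_le_power2[of "v t"] by linarith+
    then show ?thesis
      using K t by (auto simp: abs_le_square_iff[symmetric])
  qed
  \<comment> \<open>The bound on \<open>y\<close> comes from y = v - h x / 2. The added 1 keeps the
    constant positive when K = 0.\<close>
  have "\<bar>x t\<bar> \<le> (K * (1 + B) + 1) / t \<and> \<bar>y t\<bar> \<le> (K * (1 + B) + 1) / t"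
    if t: "t \<ge> max T 1" "t \<ge> t0" for t
  proof -
    have Kt: "0 \<le> K / t" using K t by simp
    have "\<bar>y t\<bar> \<le> \<bar>v t\<bar> + \<bar>h t * x t / 2\<bar>"
      unfolding v_def by linarith
    also have "\<bar>h t * x t / 2\<bar> \<le> \<bar>h t * x t\<bar>" by simp
    also have "\<bar>h t * x t\<bar> \<le> B * (K / t)"
      using B[OF t(2)] xv[OF t] unfolding abs_mult by (intro mult_mono) auto
    finally have "\<bar>y t\<bar> \<le> K / t + B * (K / t)" using xv[OF t] by linarith
    moreover have "K / t + B * (K / t) \<le> (K * (1 + B) + 1) / t"
      using t by (simp add: field_simps)
    moreover have "0 \<le> B * (K / t)" using B0 Kt by (intro mult_nonneg_nonneg) auto
    ultimately show ?thesis using xv[OF t] by linarith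
  qed
  moreover have "K * (1 + B) + 1 > 0"
    using K B0 by (intro add_nonneg_pos mult_nonneg_nonneg) auto
  ultimately show thesis using that by blast
qed

end

section \<open>The solution curve in logarithmic time\<close>

theorem theorem1p2:
  fixes t0 :: real and h h' x y :: "real \<Rightarrow> real"
  assumes h_deriv: "\<And>t. t \<ge> t0 \<Longrightarrow> (h has_real_derivative h' t) (at t within {t0..})"
    and h'_cont: "continuous_on {t0..} h'"
    and h_pos: "\<And>t. t \<ge> t0 \<Longrightarrow> h t > 0"
    and integrable: "(\<lambda>t. 2 * h' t + \<bar>h t\<bar>\<^sup>2) absolutely_integrable_on {t0..}"
    and H_asymp: "(\<lambda>t. integral {t0..t} h - 2 * ln t) \<in> O[at_top](\<lambda>_. 1)"
    and sol: "is_solution t0 h x y"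
    and nontriv: "nontrivial t0 x y"
  shows "\<exists>t1\<ge>t0. has_box_dim (solution_curve x y t1) 1"
proof -
  interpret damped_oscillator t0 h h' x y
    by unfold_locales (use assms in auto)
  obtain A T where A: "A > 0"
    and decay: "\<And>t. t \<ge> T \<Longrightarrow> t \<ge> t0 \<Longrightarrow> \<bar>x t\<bar> \<le> A / t \<and> \<bar>y t\<bar> \<le> A / t"
    using solution_decay H_asymp unfolding H_def by blast
  obtain ts where ts: "ts \<ge> t0" "(x ts, y ts) \<noteq> (0, 0)"
    using nontriv by (auto simp: nontrivial_def)
  \<comment> \<open>\<open>T\<close> gives the decay, 1 makes ln t1 nonnegative, \<open>ts\<close>
    makes the starting point nonzero, and t0 + 1 keeps the curve in the open half-line where
    derivatives are two-sided.\<close>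
  define t1 where "t1 = Max {T, 1, ts, t0 + 1}"
  have t1: "t1 \<ge> T" "t1 \<ge> 1" "t1 \<ge> ts" "t1 \<ge> t0 + 1"
    by (auto simp: t1_def)
  define B where "B = h t0 + integral {t0..} g / 2"
  have B: "0 < h t" "h t \<le> B" if "t \<ge> t0" for t
    using h_le[OF that] h_pos[OF that] by (auto simp: B_def)
  have B0: "B > 0" using B[of t0] by simp
  \<comment> \<open>Large enough for \<open>y\<close> (A), for - x - h y (A + B * A) and for the
    norm of the point (2 * A).\<close>
  define C where "C = A * (2 + B)"
  have C: "C > 0" "A \<le> C" "A + B * A \<le> C" "2 * A \<le> C"
    using A B0 by (auto simp: C_def algebra_simps intro: add_pos_pos)
  define s1 where "s1 = ln t1"
  have s1: "s1 \<ge> 0" using t1 by (simp add: s1_def)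
  define \<sigma> where "\<sigma> s = (x (exp s), y (exp s))" for s
  have exp_ge: "exp s \<ge> t1" if "s \<ge> s1" for s
    using that t1 by (metis exp_le_cancel_iff exp_ln less_le_trans s1_def zero_less_one)
  have \<sigma>: "solution_curve x y t1 = \<sigma> ` {s1..}"
  proof -
    have "{t1..} = exp ` {s1..}"
    proof (intro equalityI subsetI)
      fix t assume "t \<in> {t1..}"
      then have "t = exp (ln t)" "ln t \<ge> s1" using t1 by (auto simp: s1_def)
      then show "t \<in> exp ` {s1..}" by auto
    qed (use exp_ge in auto)
    then have "\<sigma> ` {s1..} = (\<lambda>t. (x t, y t)) ` {t1..}"
      by (simp add: \<sigma>_def image_image)
    then show ?thesis by (auto simp: solution_curve_def)
  qed
  \<comment> \<open>The chain rule for t = exp s brings in the factor exp s, which exactly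
    compensates the 1/t decay of the velocity.\<close>
  have bound: "\<bar>exp s * u\<bar> \<le> C" if "\<bar>u\<bar> \<le> C / exp s" for s u
    using that by (simp add: abs_mult field_simps)
  have velocity: "\<bar>y (exp s)\<bar> \<le> C / exp s" "\<bar>- x (exp s) - h (exp s) * y (exp s)\<bar> \<le> C / exp s"
    "norm (\<sigma> s) \<le> C * exp (- s)" if "s \<ge> s1" for s
  proof -
    let ?t = "exp s"
    have t: "?t \<ge> T" "?t \<ge> t0" using exp_ge[OF that] t1 by auto
    note d = decay[OF t]
    have mono: "a / ?t \<le> C / ?t" if "a \<le> C" for a
      using that by (simp add: divide_right_mono)
    show "\<bar>y ?t\<bar> \<le> C / ?t" using d mono[OF C(2)] by linarith
    have "\<bar>h ?t * y ?t\<bar> \<le> B * (A / ?t)"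
      using B[OF t(2)] d unfolding abs_mult by (intro mult_mono) auto
    then have "\<bar>- x ?t - h ?t * y ?t\<bar> \<le> A / ?t + B * (A / ?t)"
      using d by linarith
    also have "\<dots> = (A + B * A) / ?t" by (simp add: add_divide_distrib)
    finally have "\<bar>- x ?t - h ?t * y ?t\<bar> \<le> (A + B * A) / ?t" .
    then show "\<bar>- x ?t - h ?t * y ?t\<bar> \<le> C / ?t" using mono[OF C(3)] by linarith
    have "norm (\<sigma> s) \<le> \<bar>x ?t\<bar> + \<bar>y ?t\<bar>"
      unfolding \<sigma>_def by (metis norm_Pair_le real_norm_def)
    also have "\<dots> \<le> (2 * A) / ?t" using d by simp
    also have "\<dots> \<le> C / ?t" by (rule mono[OF C(4)])
    finally show "norm (\<sigma> s) \<le> C * exp (- s)" by (simp add: exp_minus field_simps)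
  qed
  \<comment> \<open>Each coordinate has Lipschitz constant \<open>C\<close>, and the Euclidean
    distance is at most the sum of the coordinate distances.\<close>
  have lip: "(2 * C)-lipschitz_on {s1..} \<sigma>"
  proof (rule lipschitz_onI)
    fix a b assume ab: "a \<in> {s1..}" "b \<in> {s1..}"
    have gt: "exp s > t0" if "s \<ge> s1" for s using exp_ge[OF that] t1 by simp
    have "\<bar>x (exp a) - x (exp b)\<bar> \<le> C * \<bar>a - b\<bar>"
      unfolding real_norm_def[symmetric]
    proof (rule field_differentiable_bound[of "{s1..}" "\<lambda>s. x (exp s)" "\<lambda>s. exp s * y (exp s)"])
      fix s assume s: "s \<in> {s1..}"
      show "((\<lambda>s. x (exp s)) has_real_derivative exp s * y (exp s)) (at s within {s1..})"
        using DERIV_chain2[OF DERIV_at(2)[OF gt] DERIV_exp] s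
        by (auto simp: mult.commute intro: has_field_derivative_at_within)
      show "norm (exp s * y (exp s)) \<le> C"
        using s velocity(1) bound by simp
    qed (use ab in auto)
    moreover have "\<bar>y (exp a) - y (exp b)\<bar> \<le> C * \<bar>a - b\<bar>"
      unfolding real_norm_def[symmetric]
    proof (rule field_differentiable_bound[of "{s1..}" "\<lambda>s. y (exp s)"
          "\<lambda>s. exp s * (- x (exp s) - h (exp s) * y (exp s))"])
      fix s assume s: "s \<in> {s1..}"
      show "((\<lambda>s. y (exp s)) has_real_derivative exp s * (- x (exp s) - h (exp s) * y (exp s)))
          (at s within {s1..})"
        using DERIV_chain2[OF DERIV_at(3)[OF gt] DERIV_exp] s
        by (auto simp: mult.commute intro: has_field_derivative_at_within)
      show "norm (exp s * (- x (exp s) - h (exp s) * y (exp s))) \<le> C"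
        using s velocity(2) bound by simp
    qed (use ab in auto)
    moreover have "dist (\<sigma> a) (\<sigma> b) \<le> \<bar>x (exp a) - x (exp b)\<bar> + \<bar>y (exp a) - y (exp b)\<bar>"
      unfolding \<sigma>_def dist_norm by (simp add: norm_Pair_le[THEN order_trans])
    ultimately show "dist (\<sigma> a) (\<sigma> b) \<le> 2 * C * dist a b"
      by (simp add: dist_real_def)
  qed (use C in simp)
  \<comment> \<open>Weakened to 2 * C so that it shares its constant with the Lipschitz
    bound.\<close>
  have decay_\<sigma>: "norm (\<sigma> s) \<le> 2 * C * exp (- s)" if "s \<ge> s1" for s
    using velocity(3)[OF that] C(1) by (rule_tac order_trans) auto
  have bdd: "bounded (\<sigma> ` {s1..})"
  proof (rule boundedI)
    fix p assume "p \<in> \<sigma> ` {s1..}"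
    then obtain s where s: "s \<ge> s1" "p = \<sigma> s" by auto
    have "C * exp (- s) \<le> C * 1" using s s1 C by (intro mult_left_mono) auto
    then show "norm p \<le> C" using velocity(3)[OF s(1)] s(2) by simp
  qed
  have conn: "connected (\<sigma> ` {s1..})"
    by (intro connected_continuous_image lipschitz_on_continuous_on[OF lip]) auto
  have "\<sigma> s1 \<noteq> 0"
    using nontrivial_stays[OF ts(1) t1(3) ts(2)] t1 by (auto simp: \<sigma>_def s1_def zero_prod_def)
  \<comment> \<open>The curve starts away from the origin but tends to it, so it has a second point.
    The distance between the two gives the constant of the lower area bound.\<close>
  obtain s2 where s2: "s2 \<ge> s1" "\<sigma> s1 \<noteq> \<sigma> s2"
  proof -
    have "((\<lambda>s. C * exp (- s)) \<longlongrightarrow> 0) at_top" by real_asymp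
    then have "eventually (\<lambda>s. C * exp (- s) < norm (\<sigma> s1)) at_top"
      using \<open>\<sigma> s1 \<noteq> 0\<close> by (intro order_tendstoD) auto
    then obtain s where "s \<ge> s1" "C * exp (- s) < norm (\<sigma> s1)"
      unfolding eventually_at_top_linorder by (meson max.cobounded1 max.cobounded2)
    then show thesis using that[of s] velocity(3)[of s] by force
  qed
  have "has_box_dim (\<sigma> ` {s1..}) 1"
  proof (rule has_box_dim_1I[OF bdd])
    show "0 < pi * dist (\<sigma> s1) (\<sigma> s2) / 2" using s2 by simp
    show "0 < pi * (2 * C + 2)\<^sup>2" using C by (simp add: power2_eq_square)
    show "pi * dist (\<sigma> s1) (\<sigma> s2) / 2 * \<epsilon> \<le> measure lebesgue (closed_nbhd \<epsilon> (\<sigma> ` {s1..}))"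
      if "0 < \<epsilon>" for \<epsilon>
      using s2 that by (intro measure_closed_nbhd_connected_ge conn bdd) auto
    show "measure lebesgue (closed_nbhd \<epsilon> (\<sigma> ` {s1..}))
        \<le> pi * (2 * C + 2)\<^sup>2 * (\<epsilon> * ln (1 / \<epsilon>) + 3 * \<epsilon>\<^sup>2)" if "0 < \<epsilon>" "\<epsilon> < 1" for \<epsilon>
      using that by (intro measure_closed_nbhd_lipschitz_curve_le lip decay_\<sigma> s1)
  qed
  moreover have "t1 \<ge> t0" using t1 by simp
  ultimately show ?thesis using \<sigma> by auto
qed

end
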